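(* The multi-crew $\rho$-factor dispatch rule is equivalent to the conversion algorithm, that is, to the algorithm which converts the optimal single-crew repair sequence to an $m$-crew schedule. (Both algorithms are defined in the context.)
   Context: Setting: a radial (tree) distribution network $G$ with one source and a finite set $L^D$ of damaged lines; the other lines are intact. Damaged line $l$ has repair time $p_l>0$ and weight $w_l>0$. Lines are directed away from the source. A node is energized at time $t$ if it is connected to the source by a path all of whose lines are intact or already repaired at time $t$. Contracting all nodes joined by intact lines gives a directed rooted tree whose edges are exactly the damaged lines $l=h(l)\to t(l)$, and $w_l$ is the weight of the (contracted) node $t(l)$. The soft precedence graph $P$ has node set $L^D$ and an edge $i\to j$ whenever $t(i)=h(j)$; thus $P$ is a directed forest in which each node has at most one immediate predecessor. Write $i\preceq_S j$ if $i=j$ or there is a directed path from $i$ to $j$ in $P$. An $m$-crew schedule assigns each line $l\in L^D$ to one of $m$ identical crews and a start time $S_l\ge0$; the line is repaired without interruption during $[S_l,S_l+p_l]$, each crew works on at most one line at a time, and $C_l=S_l+p_l$ is the completion time. Soft precedence does not restrict when repairs may start; the energization time of line $j$ is $E_j=\max_{i\preceq_S j}C_i$ and the harm is $\sum_{j\in L^D}w_jE_j$. A single-crew schedule is represented by a sequence of the lines of $L^D$, repaired in that order; an optimal single-crew repair sequence is one that minimizes the harm among all single-crew sequences. $\rho$-factor: for $l\in L^D$ let $\mathcal S_l$ be the set of all trees rooted at $l$ in $P$, let $N(s)$ be the set of nodes of $s\in\mathcal S_l$, and let $s_l^*\in\mathcal S_l$ be the minimal subtree satisfying $$\rho(l):=\frac{\sum_{j\in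 N(s_l^* )}w_j}{\sum_{j\in N(s_l^* )}p_j}=\max_{s\in\mathcal S_l}\frac{\sum_{j\in N(s)}w_j}{\sum_{j\in N(s)}p_j}.$$ Multi-crew $\rho$-factor dispatch rule: whenever a crew is free, say at time $t$, select among the remaining candidate lines the one with the highest $\rho$-factor. The candidate set consists of all the damaged lines that are connected to already energized nodes or connected to lines that are being repaired at time $t$. Conversion algorithm: treat the optimal single-crew repair sequence as a priority list and, whenever a crew is free, assign to it the next line from the list; the first $m$ lines in the sequence are assigned arbitrarily to the $m$ crews. Equivalence of the two algorithms is meant in the sense that at each iteration both choose the same line for repair. *)

theory Defs
  imports Complex_Main "Graph_Theory.Digraph_Component"
begin

section \<open>Damaged radial networks\<close>

definition rooted_tree :: "('a, 'b) pre_digraph \<Rightarrow> 'a \<Rightarrow> bool" where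
  "rooted_tree T r \<longleftrightarrow>
     wf_digraph T \<and> r \<in> verts T \<and> (\<forall>v \<in> verts T. \<exists>!q. pre_digraph.awalk T r q v)"

text \<open>
  The vertices of \<open>G\<close> are the nodes of the network, its arcs are the lines, directed away from
  the source \<open>src\<close>; \<open>D\<close> is the set of damaged lines, with repair times \<open>p\<close> and weights \<open>w\<close>.
\<close>
definition damaged_network ::
  "('v, 'l) pre_digraph \<Rightarrow> 'v \<Rightarrow> 'l set \<Rightarrow> ('l \<Rightarrow> real) \<Rightarrow> ('l \<Rightarrow> real) \<Rightarrow> bool" where
  "damaged_network G src D p w \<longleftrightarrow>
     rooted_tree G src \<and> D \<subseteq> arcs G \<and> finite D \<and> (\<forall>l \<in> D. p l > 0 \<and> w l > 0)"

text \<open>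
  \<open>joined G A v\<close> is the set of nodes connected to \<open>v\<close> by a path, traversed regardless of the
  direction of its lines, all of whose lines belong to \<open>A\<close>.
\<close>
definition joined :: "('v, 'l) pre_digraph \<Rightarrow> 'l set \<Rightarrow> 'v \<Rightarrow> 'v set" where
  "joined G A v = (arc_to_ends G ` A \<union> (arc_to_ends G ` A)\<inverse>)\<^sup>* `` {v}"

text \<open>
  Contracting the intact lines turns a node into its class of nodes joined by intact lines.
  A damaged line \<open>l\<close> then runs from \<open>h(l)\<close> to \<open>t(l)\<close>; beware that the graph library calls the
  initial node of an arc its tail and the final node its head, the other way round.
\<close>
definition h_node :: "('v, 'l) pre_digraph \<Rightarrow> 'l set \<Rightarrow> 'l \<Rightarrow> 'v set" where
  "h_node G D l = joined G (arcs G - D) (tail G l)"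

definition t_node :: "('v, 'l) pre_digraph \<Rightarrow> 'l set \<Rightarrow> 'l \<Rightarrow> 'v set" where
  "t_node G D l = joined G (arcs G - D) (head G l)"

definition soft_precedence :: "('v, 'l) pre_digraph \<Rightarrow> 'l set \<Rightarrow> ('l, 'l \<times> 'l) pre_digraph" where
  "soft_precedence G D =
     \<lparr> verts = D,
       arcs = {(i, j). i \<in> D \<and> j \<in> D \<and> t_node G D i = h_node G D j},
       tail = fst,
       head = snd \<rparr>"

section \<open>Harm and optimal single-crew sequences\<close>

definition energization_time ::
  "('v, 'l) pre_digraph \<Rightarrow> 'l set \<Rightarrow> ('l \<Rightarrow> real) \<Rightarrow> 'l \<Rightarrow> real" where
  "energization_time G D C j = Max {C i | i. i \<rightarrow>\<^sup>*\<^bsub>soft_precedence G D\<^esub> j}"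

definition harm ::
  "('v, 'l) pre_digraph \<Rightarrow> 'l set \<Rightarrow> ('l \<Rightarrow> real) \<Rightarrow> ('l \<Rightarrow> real) \<Rightarrow> real" where
  "harm G D w C = (\<Sum>j\<in>D. w j * energization_time G D C j)"

definition repair_sequence :: "'l set \<Rightarrow> 'l list \<Rightarrow> bool" where
  "repair_sequence D \<sigma> \<longleftrightarrow> distinct \<sigma> \<and> set \<sigma> = D"

definition sequence_completion :: "('l \<Rightarrow> real) \<Rightarrow> 'l list \<Rightarrow> 'l \<Rightarrow> real" where
  "sequence_completion p \<sigma> l = sum_list (map p (takeWhile (\<lambda>i. i \<noteq> l) \<sigma>)) + p l"

definition optimal_sequence ::
  "('v, 'l) pre_digraph \<Rightarrow> 'l set \<Rightarrow> ('l \<Rightarrow> real) \<Rightarrow> ('l \<Rightarrow> real) \<Rightarrow> 'l list \<Rightarrow> bool" where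
  "optimal_sequence G D p w \<sigma> \<longleftrightarrow>
     repair_sequence D \<sigma> \<and>
     (\<forall>\<tau>. repair_sequence D \<tau> \<longrightarrow>
        harm G D w (sequence_completion p \<sigma>) \<le> harm G D w (sequence_completion p \<tau>))"

section \<open>The \<open>\<rho>\<close>-factor\<close>

definition trees_at ::
  "('v, 'l) pre_digraph \<Rightarrow> 'l set \<Rightarrow> 'l \<Rightarrow> ('l, 'l \<times> 'l) pre_digraph set" where
  "trees_at G D l = {s. subgraph s (soft_precedence G D) \<and> rooted_tree s l}"

definition rho ::
  "('v, 'l) pre_digraph \<Rightarrow> 'l set \<Rightarrow> ('l \<Rightarrow> real) \<Rightarrow> ('l \<Rightarrow> real) \<Rightarrow> 'l \<Rightarrow> real" where
  "rho G D p w l = Max ((\<lambda>s. sum w (verts s) / sum p (verts s)) ` trees_at G D l)"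

section \<open>Multi-crew list processing\<close>

text \<open>
  At each iteration a line is given to one of the crews \<open>0, \<dots>, m - 1\<close>, which starts repairing
  it at once. A history lists the assignments made so far, in order.
\<close>
record 'l assignment =
  line :: 'l
  crew :: nat
  start :: real

definition crew_free :: "('l \<Rightarrow> real) \<Rightarrow> 'l assignment list \<Rightarrow> nat \<Rightarrow> real \<Rightarrow> bool" where
  "crew_free p H c t \<longleftrightarrow> (\<forall>a \<in> set H. crew a = c \<longrightarrow> start a + p (line a) \<le> t)"

definition repaired :: "('l \<Rightarrow> real) \<Rightarrow> 'l assignment list \<Rightarrow> real \<Rightarrow> 'l set" where
  "repaired p H t = {line a | a. a \<in> set H \<and> start a + p (line a) \<le> t}"

definition under_repair :: "('l \<Rightarrow> real) \<Rightarrow> 'l assignment list \<Rightarrow> real \<Rightarrow> 'l set" where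
  "under_repair p H t = {line a | a. a \<in> set H \<and> start a \<le> t \<and> t < start a + p (line a)}"

definition operational ::
  "('v, 'l) pre_digraph \<Rightarrow> 'l set \<Rightarrow> ('l \<Rightarrow> real) \<Rightarrow> 'l assignment list \<Rightarrow> real \<Rightarrow> 'l set" where
  "operational G D p H t = (arcs G - D) \<union> (repaired p H t \<inter> D)"

definition energized ::
  "('v, 'l) pre_digraph \<Rightarrow> 'v \<Rightarrow> 'l set \<Rightarrow> ('l \<Rightarrow> real) \<Rightarrow> 'l assignment list \<Rightarrow> real \<Rightarrow> 'v set"
  where
  "energized G src D p H t = joined G (operational G D p H t) src"

definition endpoints :: "('v, 'l) pre_digraph \<Rightarrow> 'l \<Rightarrow> 'v set" where
  "endpoints G l = {tail G l, head G l}"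

text \<open>
  A line is connected to a line under repair if endpoints of the two coincide after contracting
  the lines that are operational at time \<open>t\<close>. These include the lines repaired by then: a line
  below a repaired line that itself lies below a line still under repair is a candidate.
\<close>
definition candidates ::
  "('v, 'l) pre_digraph \<Rightarrow> 'v \<Rightarrow> 'l set \<Rightarrow> ('l \<Rightarrow> real) \<Rightarrow> 'l assignment list \<Rightarrow> real \<Rightarrow> 'l set"
  where
  "candidates G src D p H t =
     {j \<in> D - line ` set H.
        (\<exists>u \<in> endpoints G j. u \<in> energized G src D p H t) \<or>
        (\<exists>i \<in> under_repair p H t. \<exists>u \<in> endpoints G j. \<exists>v \<in> endpoints G i.
           u \<in> joined G (operational G D p H t) v)}"

text \<open>
  The dispatch rule acts at the earliest time at which some crew is free and some candidate
  exists. Ties between crews and between lines of equal \<open>\<rho>\<close>-factor are broken arbitrarily, so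
  both algorithms are relations between a history and its next assignment.
\<close>
definition dispatch_step ::
  "('v, 'l) pre_digraph \<Rightarrow> 'v \<Rightarrow> 'l set \<Rightarrow> ('l \<Rightarrow> real) \<Rightarrow> ('l \<Rightarrow> real) \<Rightarrow> nat \<Rightarrow>
   'l assignment list \<Rightarrow> 'l assignment \<Rightarrow> bool" where
  "dispatch_step G src D p w m H a \<longleftrightarrow>
     0 \<le> start a \<and> crew a < m \<and> crew_free p H (crew a) (start a) \<and>
     line a \<in> candidates G src D p H (start a) \<and>
     (\<forall>j \<in> candidates G src D p H (start a). rho G D p w j \<le> rho G D p w (line a)) \<and>
     (\<forall>t. 0 \<le> t \<and> t < start a \<longrightarrow>
        \<not> ((\<exists>c < m. crew_free p H c t) \<and> candidates G src D p H t \<noteq> {}))"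

text \<open>
  All crews are free at time \<open>0\<close>, so the first \<open>m\<close> lines of \<open>\<sigma>\<close> go to the \<open>m\<close> crews in arbitrary
  order.
\<close>
definition conversion_step ::
  "('l \<Rightarrow> real) \<Rightarrow> nat \<Rightarrow> 'l list \<Rightarrow> 'l assignment list \<Rightarrow> 'l assignment \<Rightarrow> bool" where
  "conversion_step p m \<sigma> H a \<longleftrightarrow>
     0 \<le> start a \<and> crew a < m \<and> crew_free p H (crew a) (start a) \<and>
     length H < length \<sigma> \<and> line a = \<sigma> ! length H \<and>
     (\<forall>t. 0 \<le> t \<and> t < start a \<longrightarrow> \<not> (\<exists>c < m. crew_free p H c t))"

text \<open>
  The histories an algorithm can produce, the incomplete ones included.
\<close>
inductive run :: "('a list \<Rightarrow> 'a \<Rightarrow> bool) \<Rightarrow> 'a list \<Rightarrow> bool" for step where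
  run_Nil: "run step []"
| run_snoc: "run step H \<Longrightarrow> step H a \<Longrightarrow> run step (H @ [a])"

abbreviation dispatch_run ::
  "('v, 'l) pre_digraph \<Rightarrow> 'v \<Rightarrow> 'l set \<Rightarrow> ('l \<Rightarrow> real) \<Rightarrow> ('l \<Rightarrow> real) \<Rightarrow> nat \<Rightarrow>
   'l assignment list \<Rightarrow> bool" where
  "dispatch_run G src D p w m \<equiv> run (dispatch_step G src D p w m)"

abbreviation conversion_run ::
  "('l \<Rightarrow> real) \<Rightarrow> nat \<Rightarrow> 'l list \<Rightarrow> 'l assignment list \<Rightarrow> bool" where
  "conversion_run p m \<sigma> \<equiv> run (conversion_step p m \<sigma>)"

end

theory Submission
  imports Defs
begin

text \<open>
  After contraction, the damaged lines lying upstream of a line on its route from the source form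
  a forest order. An optimal sequence respects this order: a line repaired before one of its
  upstream lines could be postponed until just after the last of them, which delays no
  energization time and advances one. On sequences that respect the order the harm is the weighted
  sum of completion times. Let \<open>l\<close> have the largest \<open>\<rho>\<close>-factor \<open>\<lambda>\<close> among the lines whose
  upstream lines are done, and move its densest subtree to the front of the remaining sequence.
  With the excess \<open>w - \<lambda> p\<close>, every set of lines jumped over splits into subtrees
  of excess at most \<open>0\<close>, and every final part of the moved subtree has excess at least \<open>0\<close>, so the
  harm does not grow; it drops if the displaced first line has a smaller \<open>\<rho>\<close>-factor. Hence
  optimal sequences are exactly the greedy ones, and every greedy prefix extends to an
  optimal sequence.

  If the assigned lines are closed under upstream lines and all repairs have started, the candidate
  set consists of the unassigned lines all of whose upstream lines are assigned. So a candidate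
  exists whenever a line is left, both algorithms act at the first time at which a crew is free,
  and the dispatch rule makes the greedy choice.
\<close>

section \<open>Moving a set of jobs to the front\<close>

text \<open>The weighted sum of completion times, grouped by repair times: \<open>p x\<close> is
  charged with the weight of \<open>x\<close> and of all jobs behind it. In this form the effect of
  a move can be followed job by job.\<close>

primrec cost :: "('l \<Rightarrow> real) \<Rightarrow> ('l \<Rightarrow> real) \<Rightarrow> 'l list \<Rightarrow> real" where
  "cost p w [] = 0"
| "cost p w (x # xs) = p x * sum_list (map w (x # xs)) + cost p w xs"

lemma cost_append:
  "cost p w (u @ v) = cost p w u + sum_list (map p u) * sum_list (map w v) + cost p w v"
  by (induction u) (auto simp: algebra_simps)

lemma sum_list_partition:
  fixes f :: "'l \<Rightarrow> real"
  shows "sum_list (map f v) =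
    sum_list (map f (filter (\<lambda>x. x \<in> S) v)) + sum_list (map f (filter (\<lambda>x. x \<notin> S) v))"
  by (induction v) auto

lemma sum_list_excess:
  fixes w p :: "'l \<Rightarrow> real"
  shows "sum_list (map (\<lambda>x. w x - lam * p x) v) = sum_list (map w v) - lam * sum_list (map p v)"
  by (induction v) (auto simp: algebra_simps)

text \<open>
  The slack \<open>a\<close> serves as induction accumulator and yields the strict decrease in the exchange
  argument.
\<close>
lemma cost_move_front:
  assumes prefix: "\<And>xs y zs. v = xs @ y # zs \<Longrightarrow> y \<in> S \<Longrightarrow>
      a + sum_list (map (\<lambda>x. w x - lam * p x) (filter (\<lambda>x. x \<notin> S) xs)) \<le> 0"
    and suffix: "\<And>xs zs. v = xs @ zs \<Longrightarrow>
      0 \<le> sum_list (map (\<lambda>x. w x - lam * p x) (filter (\<lambda>x. x \<in> S) zs))"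
    and "\<And>x. x \<in> set v \<Longrightarrow> 0 \<le> p x"
  shows "cost p w (filter (\<lambda>x. x \<in> S) v @ filter (\<lambda>x. x \<notin> S) v)
      + a * sum_list (map p (filter (\<lambda>x. x \<in> S) v)) \<le> cost p w v"
  using assms
proof (induction v arbitrary: a)
  case Nil
  then show ?case by simp
next
  case (Cons x v)
  let ?S = "filter (\<lambda>x. x \<in> S) v" and ?N = "filter (\<lambda>x. x \<notin> S) v"
  have suf: "0 \<le> sum_list (map (\<lambda>x. w x - lam * p x) (filter (\<lambda>x. x \<in> S) zs))"
    if "v = xs @ zs" for xs zs
    using Cons.prems(2)[of "x # xs" zs] that by simp
  have W: "sum_list (map w v) = sum_list (map w ?S) + sum_list (map w ?N)"
    by (rule sum_list_partition)
  show ?case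
  proof (cases "x \<in> S")
    case True
    have "a \<le> 0"
      using Cons.prems(1)[of "[]" x v] True by simp
    have "cost p w (?S @ ?N) + a * sum_list (map p ?S) \<le> cost p w v"
    proof (rule Cons.IH)
      fix xs y zs assume "v = xs @ y # zs" "y \<in> S"
      then show "a + sum_list (map (\<lambda>x. w x - lam * p x) (filter (\<lambda>x. x \<notin> S) xs)) \<le> 0"
        using Cons.prems(1)[of "x # xs" y zs] True by simp
    qed (use suf Cons.prems(3) in auto)
    moreover have "a * p x \<le> 0"
      using \<open>a \<le> 0\<close> Cons.prems(3)[of x] by (simp add: mult_nonpos_nonneg)
    ultimately show ?thesis
      using True W by (simp add: algebra_simps)
  next
    case False
    \<comment> \<open>Letting the moved jobs overtake \<open>x\<close> changes the cost by
      \<open>sum_list (map p ?S) * w x - p x * sum_list (map w ?S)\<close>. Replacing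
      \<open>w\<close> by \<open>w - lam * p\<close> leaves this difference unchanged; its first
      term then goes into the accumulator, and the suffix hypothesis controls the second.\<close>
    let ?b = "a + (w x - lam * p x)"
    have "cost p w (?S @ ?N) + ?b * sum_list (map p ?S) \<le> cost p w v"
    proof (rule Cons.IH)
      fix xs y zs assume "v = xs @ y # zs" "y \<in> S"
      then show "?b + sum_list (map (\<lambda>x. w x - lam * p x) (filter (\<lambda>x. x \<notin> S) xs)) \<le> 0"
        using Cons.prems(1)[of "x # xs" y zs] False by (simp add: algebra_simps)
    qed (use suf Cons.prems(3) in auto)
    moreover have "0 \<le> p x * (sum_list (map w ?S) - lam * sum_list (map p ?S))"
      using suf[of "[]" v] Cons.prems(3)[of x] by (simp add: sum_list_excess)
    ultimately show ?thesis
      using False W by (simp add: cost_append algebra_simps)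
  qed
qed

lemma snoc_eq_append_Cons:
  "xs @ [j] = as @ k # bs \<longleftrightarrow>
    (bs = [] \<and> as = xs \<and> k = j) \<or> (\<exists>cs. bs = cs @ [j] \<and> xs = as @ k # cs)"
  by (cases bs rule: rev_cases) auto

lemma filter_eq_append_ConsD:
  "filter P q = xs @ y # ys \<Longrightarrow> \<exists>as bs. q = as @ y # bs \<and> filter P as = xs"
proof (induction q arbitrary: xs)
  case (Cons x q)
  show ?case
  proof (cases "P x \<and> xs = []")
    case True
    then show ?thesis
      using Cons.prems by (intro exI[of _ "[]"] exI[of _ q]) auto
  next
    case False
    then obtain zs where "filter P q = zs @ y # ys" "xs = (if P x then x # zs else zs)"
      using Cons.prems by (cases xs) (auto split: if_splits)
    then obtain as bs where "q = as @ y # bs" "filter P as = zs"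
      using Cons.IH by blast
    then show ?thesis
      using \<open>xs = _\<close> by (intro exI[of _ "x # as"] exI[of _ bs]) auto
  qed
qed simp

lemma sequence_completion_Nil [simp]: "sequence_completion p [] l = p l"
  by (simp add: sequence_completion_def)

lemma sequence_completion_Cons:
  "sequence_completion p (x # xs) l = (if l = x then p x else p x + sequence_completion p xs l)"
  by (simp add: sequence_completion_def)

lemma sequence_completion_append:
  "sequence_completion p (xs @ ys) l =
    (if l \<in> set xs then sequence_completion p xs l
     else sum_list (map p xs) + sequence_completion p ys l)"
  by (induction xs) (auto simp: sequence_completion_Cons)

lemma sequence_completion_le:
  assumes "l \<in> set xs" "\<And>x. x \<in> set xs \<Longrightarrow> 0 \<le> p x"
  shows "sequence_completion p xs l \<le> sum_list (map p xs)"
  using assms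
proof (induction xs)
  case (Cons x xs)
  have "0 \<le> sum_list (map p xs)"
    using Cons.prems(2) by (intro sum_list_nonneg) auto
  then show ?case
    using Cons by (cases "l = x") (simp_all add: sequence_completion_Cons)
qed simp

lemma cost_eq_weighted_completion:
  assumes "distinct \<sigma>"
  shows "(\<Sum>j\<in>set \<sigma>. w j * sequence_completion p \<sigma> j) = cost p w \<sigma>"
  using assms
proof (induction \<sigma>)
  case (Cons x xs)
  have "(\<Sum>j\<in>set xs. w j * sequence_completion p (x # xs) j) =
      (\<Sum>j\<in>set xs. p x * w j + w j * sequence_completion p xs j)"
    using Cons.prems by (intro sum.cong) (auto simp: sequence_completion_Cons algebra_simps)
  also have "\<dots> = p x * sum_list (map w xs) + cost p w xs"
    using Cons by (simp add: sum.distrib sum_distrib_left sum_list_distinct_conv_sum_set)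
  finally show ?case
    using Cons.prems by (simp add: sequence_completion_Cons algebra_simps)
qed simp

section \<open>Single-crew repair under forest precedence\<close>

text \<open>\<open>anc j\<close> stands for the proper predecessors of \<open>j\<close>;
  \<open>anc_chain\<close> is what makes the order a forest. The locale separates the scheduling
  argument from the network.\<close>

locale precedence_forest =
  fixes D :: "'l set" and anc :: "'l \<Rightarrow> 'l set" and p w :: "'l \<Rightarrow> real"
  assumes finite_D: "finite D"
    and anc_subset: "j \<in> D \<Longrightarrow> anc j \<subseteq> D"
    and anc_trans: "j \<in> D \<Longrightarrow> i \<in> anc j \<Longrightarrow> anc i \<subseteq> anc j"
    and anc_irrefl: "j \<in> D \<Longrightarrow> j \<notin> anc j"
    and anc_chain: "j \<in> D \<Longrightarrow> i \<in> anc j \<Longrightarrow> k \<in> anc j \<Longrightarrow> i = k \<or> i \<in> anc k \<or> k \<in> anc i"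
    and p_pos: "j \<in> D \<Longrightarrow> 0 < p j"
    and w_pos: "j \<in> D \<Longrightarrow> 0 < w j"
begin

text \<open>Subtrees rooted at \<open>l\<close>, encoded by their nodes: all members lie below
  \<open>l\<close>, and nothing between \<open>l\<close> and a member is missing. The \<rho>-factor
  depends on a subtree only through its nodes.\<close>

definition tree_at :: "'l \<Rightarrow> 'l set \<Rightarrow> bool" where
  "tree_at l N \<longleftrightarrow> l \<in> N \<and> N \<subseteq> D \<and>
    (\<forall>x\<in>N. x \<noteq> l \<longrightarrow> l \<in> anc x \<and> (\<forall>y\<in>anc x. l \<in> anc y \<longrightarrow> y \<in> N))"

definition density :: "'l \<Rightarrow> real" where
  "density l = Max ((\<lambda>N. sum w N / sum p N) ` Collect (tree_at l))"

text \<open>Linearizes the density: on nonempty subsets of \<open>D\<close> its sign compares weight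
  per repair time with \<open>lam\<close>, and unlike the ratio it is additive over disjoint
  sets.\<close>

definition excess :: "real \<Rightarrow> 'l set \<Rightarrow> real" where
  "excess lam N = (\<Sum>x\<in>N. w x - lam * p x)"

definition ready :: "'l set \<Rightarrow> 'l set" where
  "ready A = {j \<in> D - A. anc j \<subseteq> A}"

definition topo :: "'l list \<Rightarrow> bool" where
  "topo \<sigma> \<longleftrightarrow> (\<forall>xs j ys. \<sigma> = xs @ j # ys \<longrightarrow> anc j \<subseteq> set xs)"

text \<open>Imposed at each position of a list that need not exhaust \<open>D\<close>, so that it
  also applies to the lines assigned so far.\<close>

definition greedy :: "'l list \<Rightarrow> bool" where
  "greedy \<sigma> \<longleftrightarrow> (\<forall>xs j ys. \<sigma> = xs @ j # ys \<longrightarrow>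
     j \<in> ready (set xs) \<and> (\<forall>k\<in>ready (set xs). density k \<le> density j))"

text \<open>The harm in terms of \<open>anc\<close>. For a repair sequence it can exceed
  \<open>cost p w\<close> when some predecessor is repaired late.\<close>

definition delay_cost :: "'l list \<Rightarrow> real" where
  "delay_cost \<sigma> = (\<Sum>j\<in>D. w j * Max (sequence_completion p \<sigma> ` insert j (anc j)))"

definition optimal :: "'l list \<Rightarrow> bool" where
  "optimal \<sigma> \<longleftrightarrow> repair_sequence D \<sigma> \<and>
     (\<forall>\<tau>. repair_sequence D \<tau> \<longrightarrow> delay_cost \<sigma> \<le> delay_cost \<tau>)"

section \<open>Predecessor chains, ready lines and dense subtrees\<close>

lemma finite_subset_D: "N \<subseteq> D \<Longrightarrow> finite N"
  using finite_D by (rule rev_finite_subset)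

lemma finite_anc: "j \<in> D \<Longrightarrow> finite (anc j)"
  using anc_subset finite_subset_D by blast

lemma psubset_anc: "j \<in> D \<Longrightarrow> i \<in> anc j \<Longrightarrow> anc i \<subset> anc j"
  using anc_trans anc_irrefl anc_subset by blast

text \<open>Predecessor sets shrink strictly along the order, so their cardinality serves as a
  measure.\<close>

lemma anc_induct [consumes 1, case_names step]:
  assumes "j \<in> D" "\<And>j. j \<in> D \<Longrightarrow> (\<And>i. i \<in> anc j \<Longrightarrow> P i) \<Longrightarrow> P j"
  shows "P j"
  using assms(1)
proof (induction "card (anc j)" arbitrary: j rule: less_induct)
  case less
  then show ?case
    using assms(2)[of j] psubset_anc psubset_card_mono finite_anc anc_subset by (meson subsetD)
qed

text \<open>The predecessors form a chain; its member with the most predecessors of its own is the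
  immediate predecessor.\<close>

lemma anc_eq_insert:
  assumes "j \<in> D" "anc j \<noteq> {}"
  obtains i where "i \<in> anc j" "anc j = insert i (anc i)"
proof -
  from assms obtain i where i: "i \<in> anc j" "\<forall>k\<in>anc j. card (anc k) \<le> card (anc i)"
    using finite_anc obtains_MAX[of "anc j" "\<lambda>k. card (anc k)"] by (metis Max_ge finite_imageI imageI)
  have "k \<in> insert i (anc i)" if k: "k \<in> anc j" for k
  proof (rule ccontr)
    assume "k \<notin> insert i (anc i)"
    then have "i \<in> anc k"
      using anc_chain[OF assms(1) i(1) k] by auto
    then have "card (anc i) < card (anc k)"
      using psubset_anc[of k i] k anc_subset[OF assms(1)] finite_anc
      by (meson psubset_card_mono subsetD)
    with i(2) k show False by fastforce
  qed
  then have "anc j = insert i (anc i)"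
    using i(1) anc_trans[OF assms(1) i(1)] by blast
  with i(1) show thesis by (rule that)
qed

text \<open>Climbing from \<open>j\<close> through unfinished predecessors ends at a ready line.
  With \<open>ready_unique\<close>, the ready lines become the roots of a partition of the
  unfinished lines.\<close>

lemma ready_nonempty:
  assumes "j \<in> D - A"
  shows "ready A \<inter> insert j (anc j) \<noteq> {}"
proof -
  have "j \<in> D" using assms by simp
  then have "j \<notin> A \<longrightarrow> ready A \<inter> insert j (anc j) \<noteq> {}"
  proof (induction j rule: anc_induct)
    case (step j)
    show ?case
    proof (cases "anc j \<subseteq> A")
      case True
      then show ?thesis using step(1) by (auto simp: ready_def)
    next
      case False
      then obtain i where "i \<in> anc j" "i \<notin> A" by auto
      then show ?thesis using step anc_trans by blast
    qed
  qed
  then show ?thesis using assms by simp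
qed

text \<open>Two lines on one chain are comparable, and the lower one is not ready while the upper
  one is unfinished.\<close>

lemma ready_unique:
  assumes "j \<in> D" "r \<in> ready A \<inter> insert j (anc j)" "s \<in> ready A \<inter> insert j (anc j)"
  shows "r = s"
  using assms anc_chain[of j r s] unfolding ready_def by auto

lemma sum_p_pos:
  assumes "l \<in> N" "N \<subseteq> D"
  shows "0 < sum p N"
  using assms finite_subset_D p_pos by (intro sum_pos) auto

lemma finite_trees: "finite (Collect (tree_at l))"
  by (rule finite_subset[of _ "Pow D"]) (auto simp: tree_at_def finite_D)

lemma excess_eq: "excess lam N = sum w N - lam * sum p N"
  by (simp add: excess_def sum_subtractf sum_distrib_left)

text \<open>At \<open>lam = density l\<close> no subtree at \<open>l\<close> has positive excess; at
  larger \<open>lam\<close> the bound is negative, which is the source of the strict gain in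
  \<open>exchange\<close>.\<close>

lemma excess_tree:
  assumes "tree_at l N"
  shows "excess lam N \<le> (density l - lam) * sum p N"
proof -
  have "sum w N / sum p N \<le> density l"
    unfolding density_def using assms finite_trees by (intro Max_ge) auto
  moreover have "0 < sum p N"
    using assms sum_p_pos by (auto simp: tree_at_def)
  ultimately show ?thesis
    by (simp add: excess_eq field_simps)
qed

lemma densest_tree:
  assumes "l \<in> D"
  obtains S where "tree_at l S" "excess (density l) S = 0"
proof -
  have "tree_at l {l}"
    using assms by (auto simp: tree_at_def)
  then have "density l \<in> (\<lambda>N. sum w N / sum p N) ` Collect (tree_at l)"
    unfolding density_def using finite_trees by (intro Max_in) auto
  then obtain S where S: "tree_at l S" "density l = sum w S / sum p S"
    by auto
  then have "0 < sum p S"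
    using sum_p_pos by (auto simp: tree_at_def)
  with S have "excess (density l) S = 0"
    by (simp add: excess_eq)
  with S(1) show thesis by (rule that)
qed

lemma repair_sequence_exists: "\<exists>\<sigma>. repair_sequence D \<sigma>"
  using finite_distinct_list[OF finite_D] by (auto simp: repair_sequence_def)

lemma optimal_exists: "\<exists>\<sigma>. optimal \<sigma>"
proof -
  have fin: "finite (Collect (repair_sequence D))"
    by (rule finite_subset[OF _ finite_subset_distinct[OF finite_D]]) (auto simp: repair_sequence_def)
  moreover have "Collect (repair_sequence D) \<noteq> {}"
    using repair_sequence_exists by simp
  ultimately obtain \<sigma> where "is_arg_min delay_cost (\<lambda>\<sigma>. \<sigma> \<in> Collect (repair_sequence D)) \<sigma>"
    using ex_is_arg_min_if_finite by blast
  then have "optimal \<sigma>"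
    by (auto simp: optimal_def is_arg_min_def not_less)
  then show ?thesis ..
qed

section \<open>Sequences that respect the order\<close>

lemma topoD: "topo (xs @ j # ys) \<Longrightarrow> anc j \<subseteq> set xs"
  by (auto simp: topo_def)

lemma topo_appendD: "topo (xs @ ys) \<Longrightarrow> topo xs"
  by (auto simp: topo_def)

lemma topo_anc_closed: "topo xs \<Longrightarrow> j \<in> set xs \<Longrightarrow> anc j \<subseteq> set xs"
  by (auto dest!: split_list topoD)

lemma greedy_snoc:
  "greedy (xs @ [j]) \<longleftrightarrow>
    greedy xs \<and> j \<in> ready (set xs) \<and> (\<forall>k\<in>ready (set xs). density k \<le> density j)"
  unfolding greedy_def snoc_eq_append_Cons by blast

lemma greedy_appendD: "greedy (xs @ ys) \<Longrightarrow> greedy xs"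
  unfolding greedy_def by (metis append_assoc append_Cons)

lemma greedy_topo: "greedy \<sigma> \<Longrightarrow> topo \<sigma>"
  by (auto simp: greedy_def topo_def ready_def)


lemma greedy_assigned:
  assumes "greedy xs"
  shows "set xs \<subseteq> D" "i \<in> set xs \<Longrightarrow> anc i \<subseteq> set xs"
proof -
  show "i \<in> set xs \<Longrightarrow> anc i \<subseteq> set xs"
    using topo_anc_closed[OF greedy_topo[OF assms]] .
  show "set xs \<subseteq> D"
    using assms by (auto simp: greedy_def ready_def dest!: split_list)
qed

section \<open>Exchange with a densest subtree\<close>

lemma topo_move_front:
  assumes "topo (u @ q)" "l \<in> ready (set u)" "tree_at l S"
  shows "topo (u @ filter (\<lambda>x. x \<in> S) q @ filter (\<lambda>x. x \<notin> S) q)"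
  unfolding topo_def
proof (intro allI impI)
  fix xs j ys
  assume "u @ filter (\<lambda>x. x \<in> S) q @ filter (\<lambda>x. x \<notin> S) q = xs @ j # ys"
  then consider (u) zs where "u = xs @ j # zs"
    | (S) zs ws where "xs = u @ zs" "filter (\<lambda>x. x \<in> S) q = zs @ j # ws"
    | (N) zs ws where "xs = u @ filter (\<lambda>x. x \<in> S) q @ zs" "filter (\<lambda>x. x \<notin> S) q = zs @ j # ws"
    by (auto simp: append_eq_append_conv2 Cons_eq_append_conv append_eq_Cons_conv)
  then show "anc j \<subseteq> set xs"
  proof cases
    case u
    then show ?thesis
      using assms(1) topoD[of xs j "zs @ q"] by simp
  next
    case S
    then obtain as bs where q: "q = as @ j # bs" "filter (\<lambda>x. x \<in> S) as = zs"
      by (blast dest: filter_eq_append_ConsD)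
    then have sub: "anc j \<subseteq> set u \<union> set as"
      using assms(1) topoD[of "u @ as" j bs] by simp
    have "j \<in> S"
      using arg_cong[OF S(2), of set] by auto
    then have j: "j \<in> D" "j = l \<or> l \<in> anc j \<and> (\<forall>y\<in>anc j. l \<in> anc y \<longrightarrow> y \<in> S)" "l \<in> S"
      using assms(3) by (auto simp: tree_at_def)
    \<comment> \<open>A predecessor of a moved line lies above \<open>l\<close>, hence in
      \<open>u\<close> because \<open>l\<close> is ready, or it is \<open>l\<close>, or it lies
      between \<open>l\<close> and \<open>j\<close>, hence in \<open>S\<close>.\<close>
    have "y \<in> set u \<or> y \<in> S" if "y \<in> anc j" for y
      using that j assms(2) anc_chain[of j l y] by (auto simp: ready_def)
    with sub show ?thesis
      unfolding S(1) q(2)[symmetric] by auto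
  next
    case N
    then obtain as bs where q: "q = as @ j # bs" "filter (\<lambda>x. x \<notin> S) as = zs"
      by (blast dest: filter_eq_append_ConsD)
    then have "anc j \<subseteq> set u \<union> set as"
      using assms(1) topoD[of "u @ as" j bs] by simp
    then show ?thesis
      using q N(1) by auto
  qed
qed

text \<open>A densest ready line may come next at no extra cost. The strict conclusion shows that
  optimal sequences are greedy; the weak one lets ties be broken in any way.\<close>

lemma exchange:
  assumes rep: "repair_sequence D (u @ x # v)" and topo: "topo (u @ x # v)"
    and l: "l \<in> ready (set u)" and max: "\<forall>k\<in>ready (set u). density k \<le> density l"
  obtains v' where "repair_sequence D (u @ l # v')" "topo (u @ l # v')"
    "cost p w (u @ l # v') \<le> cost p w (u @ x # v)"
    "density x < density l \<Longrightarrow> cost p w (u @ l # v') < cost p w (u @ x # v)"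
proof -
  define q where "q = x # v"
  define A where "A = set u"
  have "l \<in> D" "l \<notin> A" "anc l \<subseteq> A"
    using l by (auto simp: ready_def A_def)
  obtain S where S: "tree_at l S" and S0: "excess (density l) S = 0"
    using densest_tree \<open>l \<in> D\<close> by blast
  have "l \<in> S" "S \<subseteq> D" "finite S"
    using S finite_subset_D by (auto simp: tree_at_def)
  have S_root: "l \<in> insert z (anc z)" if "z \<in> S" for z
    using S that by (auto simp: tree_at_def)
  have S_closed: "t \<in> S" if "z \<in> S" "z \<noteq> l" "t \<in> anc z" "l \<in> anc t" for z t
    using S that unfolding tree_at_def by blast
  have D: "set q = D - A" "distinct (u @ q)" "A \<subseteq> D"
    using rep by (auto simp: repair_sequence_def q_def A_def)
  have topo': "topo (u @ q)"
    using topo by (simp add: q_def)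
  have closedA: "anc z \<subseteq> A" if "z \<in> A" for z
    using topo_anc_closed[OF topo_appendD[OF topo']] that by (simp add: A_def)
  have below: "z \<notin> A" if "l \<in> insert z (anc z)" for z
    using that closedA \<open>l \<notin> A\<close> by auto
  have "x \<in> ready A"
    using topoD[OF topo] rep by (auto simp: ready_def A_def repair_sequence_def)
  have x_S: "x = l" if "x \<in> S"
    using S_root[OF that] \<open>x \<in> ready A\<close> \<open>l \<notin> A\<close> by (auto simp: ready_def)
  let ?f = "\<lambda>x. w x - density l * p x"
  let ?M = "filter (\<lambda>x. x \<in> S) q" and ?N = "filter (\<lambda>x. x \<notin> S) q"
  \<comment> \<open>The slack in \<open>cost_move_front\<close>: if \<open>x\<close> is displaced,
    the lines jumped over include the part of the sequence rooted at \<open>x\<close>, whose excess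
    is at most \<open>- ?a\<close>.\<close>
  let ?a = "(density l - density x) * p x"
  have list_excess: "sum_list (map ?f xs) = excess (density l) (set xs)" if "distinct xs" for xs
    using that by (simp add: excess_def sum_list_distinct_conv_sum_set)
  have closedX: "anc z \<subseteq> A \<union> set xs" if "q = xs @ zs" "z \<in> set xs" for xs zs z
    using topo_anc_closed[of "u @ xs" z] topo_appendD[of "u @ xs" zs] topo' that
    by (simp add: A_def)

  have "cost p w (?M @ ?N) + ?a * sum_list (map p ?M) \<le> cost p w q"
  proof (rule cost_move_front)
    fix xs y zs
    assume q: "q = xs @ y # zs" "y \<in> S"
    \<comment> \<open>The jumped-over segment \<open>xs\<close> splits into the sets
      \<open>T r\<close>, one for each ready root \<open>r\<close>; each is a subtree, since the
      sequence respects the order.\<close>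
    define T where "T r = {z \<in> set xs. r \<in> insert z (anc z)}" for r
    let ?R = "ready A \<inter> set xs"
    have X: "set xs \<subseteq> D - A"
      using D q by (auto simp: A_def)
    have tree: "tree_at r (T r)" if r: "r \<in> ?R" for r
      unfolding tree_at_def
    proof (intro conjI ballI impI)
      fix z t assume z: "z \<in> T r" "z \<noteq> r" "t \<in> anc z" "r \<in> anc t"
      then have "t \<in> A \<union> set xs"
        using closedX[OF q(1)] by (auto simp: T_def)
      moreover have "t \<notin> A"
        using z r closedA by (auto simp: ready_def)
      ultimately show "t \<in> T r"
        using z by (auto simp: T_def)
    qed (use r X in \<open>auto simp: T_def\<close>)
    \<comment> \<open>The factor \<open>density r - density l\<close> is nonpositive, so
      \<open>sum p (T r)\<close> may be replaced by its summand \<open>p r\<close>. For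
      \<open>r = x\<close> the bound becomes exactly \<open>- ?a\<close>.\<close>
    have bound: "excess (density l) (T r) \<le> (density r - density l) * p r" if r: "r \<in> ?R" for r
    proof -
      have "p r \<le> sum p (T r)"
        using r X p_pos by (intro member_le_sum) (auto simp: T_def less_imp_le)
      moreover have "density r - density l \<le> 0"
        using r max by (simp add: A_def)
      ultimately have "(density r - density l) * sum p (T r) \<le> (density r - density l) * p r"
        by (rule mult_left_mono_neg)
      then show ?thesis
        using excess_tree[OF tree[OF r], of "density l"] by linarith
    qed
    have rest: "excess (density l) (T r - S) \<le> (if r = x then - ?a else 0)" if r: "r \<in> ?R" for r
    proof (cases "r = l")
      case True
      \<comment> \<open>\<open>T l - S\<close> lacks the root \<open>l\<close> and is thus no
        subtree at \<open>l\<close>. The union with \<open>S\<close> is one, and \<open>S\<close>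
        has excess 0, so the bound for the union passes to the difference.\<close>
      have "tree_at l (T l \<union> S)"
        unfolding tree_at_def
      proof (intro conjI ballI impI)
        fix z t assume z: "z \<in> T l \<union> S" "z \<noteq> l" "t \<in> anc z" "l \<in> anc t"
        show "t \<in> T l \<union> S"
        proof (cases "z \<in> S")
          case True
          then show ?thesis using S_closed z by blast
        next
          case False
          then have "t \<in> A \<union> set xs"
            using z closedX[OF q(1)] by (auto simp: T_def)
          then show ?thesis
            using z below[of t] by (auto simp: T_def)
        qed
      qed (use X \<open>l \<in> S\<close> \<open>S \<subseteq> D\<close> S_root in \<open>auto simp: T_def\<close>)
      then have "excess (density l) (T l \<union> S) \<le> 0"
        using excess_tree[of l "T l \<union> S" "density l"] by simp
      moreover have "excess (density l) (T l \<union> S) = excess (density l) (T l - S) + excess (density l) S"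
        using \<open>finite S\<close> unfolding excess_def
        by (subst sum.union_disjoint[symmetric]) (auto simp: T_def Un_commute)
      ultimately show ?thesis
        using S0 True by auto
    next
      case False
      have "T r \<inter> S = {}"
      proof (rule ccontr)
        assume "T r \<inter> S \<noteq> {}"
        then obtain z where "z \<in> T r" "z \<in> S" by auto
        then have "r = l"
          using ready_unique[of z r A l] S_root[of z] r l X by (auto simp: T_def A_def)
        with False show False ..
      qed
      then have "T r - S = T r" by auto
      moreover have "(density r - density l) * p r \<le> 0"
        using r max X p_pos[of r] by (intro mult_nonpos_nonneg) (auto simp: A_def)
      ultimately show ?thesis
        using bound[OF r] by (auto simp: algebra_simps)
    qed
    have "excess (density l) (set xs - S) = (\<Sum>r\<in>?R. excess (density l) (T r - S))"
    proof -
      have "set xs - S \<subseteq> (\<Union>r\<in>?R. T r - S)"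
      proof
        fix z assume z: "z \<in> set xs - S"
        then obtain r where r: "r \<in> ready A" "r \<in> insert z (anc z)"
          using ready_nonempty[of z A] X by auto
        then have "r \<in> set xs"
          using z closedX[OF q(1)] by (auto simp: ready_def)
        then show "z \<in> (\<Union>r\<in>?R. T r - S)"
          using r z by (auto simp: T_def)
      qed
      then have eq: "set xs - S = (\<Union>r\<in>?R. T r - S)"
        by (auto simp: T_def)
      have disj: "(T r - S) \<inter> (T s - S) = {}" if "r \<in> ?R" "s \<in> ?R" "r \<noteq> s" for r s
        using that ready_unique[of _ r A s] X by (auto simp: T_def)
      have "finite (T r - S)" for r
        by (simp add: T_def)
      with disj show ?thesis
        unfolding excess_def eq by (intro sum.UNION_disjoint) auto
    qed
    also have "\<dots> \<le> (\<Sum>r\<in>?R. if r = x then - ?a else 0)"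
      using rest by (rule sum_mono)
    also have "\<dots> = (if x \<in> ?R then - ?a else 0)"
      by simp
    \<comment> \<open>For \<open>x = l\<close> the slack is 0. Otherwise \<open>x\<close> is not in
      \<open>S\<close>, so the first member of \<open>S\<close> met comes after \<open>x\<close> and
      \<open>x\<close> is among the lines jumped over.\<close>
    also have "\<dots> \<le> - ?a"
    proof (cases "x = l")
      case False
      then have "xs \<noteq> []"
        using q x_S by (auto simp: q_def)
      then have "x \<in> set xs"
        using q by (cases xs) (auto simp: q_def)
      then show ?thesis
        using \<open>x \<in> ready A\<close> by simp
    qed simp
    finally have "excess (density l) (set xs - S) \<le> - ?a" .
    moreover have "sum_list (map ?f (filter (\<lambda>x. x \<notin> S) xs)) = excess (density l) (set xs - S)"
      using D(2) q by (subst list_excess) (auto simp: set_diff_eq)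
    ultimately show "?a + sum_list (map ?f (filter (\<lambda>x. x \<notin> S) xs)) \<le> 0"
      by linarith
  next
    fix xs zs assume q: "q = xs @ zs"
    have X: "set xs \<subseteq> D" using D q by auto
    \<comment> \<open>The part of \<open>S\<close> in an initial segment is empty or again a subtree
      at \<open>l\<close>. As the total excess of \<open>S\<close> is 0, the remaining part has
      nonnegative excess.\<close>
    have "excess (density l) (S \<inter> set xs) \<le> 0"
    proof (cases "S \<inter> set xs = {}")
      case False
      then obtain z where z: "z \<in> S" "z \<in> set xs" by auto
      then have "l \<in> set xs"
        using S_root[of z] closedX[OF q, of z] \<open>l \<notin> A\<close> by auto
      have "tree_at l (S \<inter> set xs)"
        unfolding tree_at_def
      proof (intro conjI ballI impI)
        fix z t assume z: "z \<in> S \<inter> set xs" "z \<noteq> l" "t \<in> anc z" "l \<in> anc t"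
        then have "t \<in> S" "t \<in> A \<union> set xs" "t \<notin> A"
          using S_closed closedX[OF q] below[of t] by blast+
        then show "t \<in> S \<inter> set xs" by simp
      qed (use \<open>l \<in> S\<close> \<open>l \<in> set xs\<close> \<open>S \<subseteq> D\<close> S_root in auto)
      then show ?thesis
        using excess_tree[of l "S \<inter> set xs" "density l"] by simp
    qed (simp add: excess_def)
    moreover have "S - set xs = S \<inter> set zs"
    proof -
      have "z \<in> set xs \<or> z \<in> set zs" if "z \<in> S" for z
        using below[OF S_root[OF that]] that \<open>S \<subseteq> D\<close> D(1) q by auto
      then show ?thesis
        using D(2) q by auto
    qed
    then have "excess (density l) S = excess (density l) (S \<inter> set xs) + excess (density l) (S \<inter> set zs)"
      using sum.Int_Diff[OF \<open>finite S\<close>, of _ "set xs"] by (simp add: excess_def)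
    ultimately have "0 \<le> excess (density l) (S \<inter> set zs)"
      using S0 by simp
    moreover have "sum_list (map ?f (filter (\<lambda>x. x \<in> S) zs)) = excess (density l) (S \<inter> set zs)"
      using D(2) q by (subst list_excess) (auto intro: arg_cong[where f = "excess _"])
    ultimately show "0 \<le> sum_list (map ?f (filter (\<lambda>x. x \<in> S) zs))"
      by simp
  next
    fix y assume "y \<in> set q"
    then show "0 \<le> p y"
      using D p_pos by (simp add: less_imp_le)
  qed
  moreover have "cost p w (u @ ?M @ ?N) - cost p w (u @ q) = cost p w (?M @ ?N) - cost p w q"
    using sum_list_partition[of w q S] by (simp add: cost_append)
  ultimately have cost: "cost p w (u @ ?M @ ?N) + ?a * sum_list (map p ?M) \<le> cost p w (u @ q)"
    by linarith
  have rep': "repair_sequence D (u @ ?M @ ?N)"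
    using D by (auto simp: repair_sequence_def A_def)
  have topo'': "topo (u @ ?M @ ?N)"
    by (rule topo_move_front[OF topo' l S])
  have "l \<in> set ?M"
    using \<open>l \<in> S\<close> \<open>l \<in> D\<close> \<open>l \<notin> A\<close> D by auto
  then obtain y M' where M: "?M = y # M'"
    by (cases ?M) auto
  then have "y \<in> set ?M" by simp
  then have "y \<in> S" by simp
  \<comment> \<open>The moved block starts with \<open>l\<close>: its first line \<open>y\<close>
    has all predecessors in \<open>A\<close>, while \<open>l\<close> is outside \<open>A\<close> and
    is \<open>y\<close> or a predecessor of \<open>y\<close>.\<close>
  moreover have "anc y \<subseteq> A"
    using topoD[of u y "M' @ ?N"] topo'' M by (simp add: A_def)
  ultimately have "y = l"
    using S_root \<open>l \<notin> A\<close> by auto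
  have "0 < sum_list (map p ?M)"
  proof -
    have "0 < sum p (set ?M)"
      using \<open>l \<in> set ?M\<close> D by (intro sum_p_pos[of l]) auto
    then show ?thesis
      using D by (simp add: sum_list_distinct_conv_sum_set)
  qed
  moreover have "density x \<le> density l" "0 < p x"
    using max \<open>x \<in> ready A\<close> p_pos by (auto simp: A_def ready_def)
  ultimately have gain: "0 \<le> ?a * sum_list (map p ?M)"
    "density x < density l \<Longrightarrow> 0 < ?a * sum_list (map p ?M)"
    by simp_all
  show thesis
  proof (rule that)
    show "repair_sequence D (u @ l # (M' @ ?N))" "topo (u @ l # (M' @ ?N))"
      using rep' topo'' M \<open>y = l\<close> by simp_all
    show "cost p w (u @ l # (M' @ ?N)) \<le> cost p w (u @ x # v)"
      using cost gain(1) M \<open>y = l\<close> by (simp add: q_def)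
    show "cost p w (u @ l # (M' @ ?N)) < cost p w (u @ x # v)" if "density x < density l"
      using cost gain(2)[OF that] M \<open>y = l\<close> by (simp add: q_def)
  qed
qed

section \<open>From harm to weighted completion times\<close>

lemma delay_cost_topo:
  assumes "repair_sequence D \<sigma>" "topo \<sigma>"
  shows "delay_cost \<sigma> = cost p w \<sigma>"
proof -
  have \<sigma>: "distinct \<sigma>" "set \<sigma> = D"
    using assms(1) by (auto simp: repair_sequence_def)
  \<comment> \<open>All predecessors of \<open>j\<close> stand before it, so the maximum is attained
    at \<open>j\<close>.\<close>
  have "Max (sequence_completion p \<sigma> ` insert j (anc j)) = sequence_completion p \<sigma> j"
    if j: "j \<in> D" for j
  proof (rule Max_eqI)
    obtain xs ys where eq: "\<sigma> = xs @ j # ys"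
      using j \<sigma>(2) split_list by metis
    fix t assume "t \<in> sequence_completion p \<sigma> ` insert j (anc j)"
    then obtain i where i: "t = sequence_completion p \<sigma> i" "i = j \<or> i \<in> anc j" by auto
    show "t \<le> sequence_completion p \<sigma> j"
    proof (cases "i = j")
      case False
      with i have "i \<in> set xs"
        using topoD assms(2) eq by auto
      then have "t \<le> sum_list (map p xs)"
        using i(1) eq \<sigma> less_imp_le[OF p_pos]
        by (auto simp: sequence_completion_append intro!: sequence_completion_le)
      then show ?thesis
        using eq \<sigma> p_pos[OF j] by (simp add: sequence_completion_append sequence_completion_Cons)
    qed (use i in simp)
  qed (use j finite_anc in auto)
  then show ?thesis
    unfolding delay_cost_def using cost_eq_weighted_completion[OF \<sigma>(1), of w p] \<sigma>(2) by simp
qed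

text \<open>A line \<open>j\<close> placed before one of its predecessors is postponed until right
  after the last of them, \<open>i\<close>. No maximum in the harm grows, and the one for
  \<open>i\<close> drops.\<close>

lemma not_topo_improvable:
  assumes rep: "repair_sequence D \<sigma>" and "\<not> topo \<sigma>"
  obtains \<tau> where "repair_sequence D \<tau>" "delay_cost \<tau> < delay_cost \<sigma>"
proof -
  obtain A j R where \<sigma>: "\<sigma> = A @ j # R" "\<not> anc j \<subseteq> set A"
    using assms(2) by (auto simp: topo_def)
  have dist: "distinct (A @ j # R)" "D = insert j (set A \<union> set R)"
    using rep \<sigma>(1) by (auto simp: repair_sequence_def)
  then have j: "j \<in> D" by simp
  have "\<exists>i\<in>set R. i \<in> anc j"
    using \<sigma>(2) anc_subset[OF j] anc_irrefl[OF j] dist by auto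
  \<comment> \<open>Choosing the last predecessor keeps \<open>C\<close> free of predecessors of
    \<open>j\<close>, and thus of predecessors of \<open>i\<close>.\<close>
  then obtain B i C where R: "R = B @ i # C" "i \<in> anc j" "\<forall>y\<in>set C. y \<notin> anc j"
    using split_list_last_prop[of R "\<lambda>i. i \<in> anc j"] by blast
  define \<tau> where "\<tau> = A @ B @ i # j # C"
  let ?c = "sequence_completion p"
  have rep': "repair_sequence D \<tau>"
    using dist R by (auto simp: repair_sequence_def \<tau>_def)
  have pos: "0 < p y" if "y \<in> set A \<union> set B \<union> set C \<union> {i, j}" for y
    using that dist R p_pos by auto
  have moved: "?c \<tau> y \<le> ?c \<sigma> y" if "y \<in> D" "y \<noteq> j" for y
    using that dist R pos[of j]
    by (auto simp: \<tau>_def \<sigma>(1) sequence_completion_append sequence_completion_Cons)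
  have c_j: "?c \<tau> j = ?c \<sigma> i"
    using dist R by (auto simp: \<tau>_def \<sigma>(1) sequence_completion_append sequence_completion_Cons)
  \<comment> \<open>\<open>i\<close> and its predecessors avoid \<open>j\<close> and
    \<open>C\<close>, so they all finish without waiting for \<open>j\<close>, before the old
    completion of \<open>i\<close>.\<close>
  have early: "?c \<tau> y < ?c \<sigma> i" if y: "y \<in> insert i (anc i)" for y
  proof -
    have "y \<in> anc j" "y \<noteq> j"
      using y R(2) anc_trans[OF j R(2)] anc_irrefl[OF j] by auto
    then have "y \<in> set A \<union> set B \<union> {i}"
      using R dist anc_subset[OF j] by auto
    moreover have "?c A y \<le> sum_list (map p A)" if "y \<in> set A"
      using that pos by (intro sequence_completion_le) (auto simp: less_imp_le)
    moreover have "?c B y \<le> sum_list (map p B)" if "y \<in> set B"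
      using that pos by (intro sequence_completion_le) (auto simp: less_imp_le)
    moreover have "0 \<le> sum_list (map p B)"
      using pos by (intro sum_list_nonneg) (auto simp: less_imp_le)
    ultimately show ?thesis
      using dist R pos[of i] pos[of j] \<open>y \<noteq> j\<close>
      by (auto simp: \<tau>_def \<sigma>(1) sequence_completion_append sequence_completion_Cons)
  qed
  have fin: "finite (insert k (anc k))" if "k \<in> D" for k
    using that finite_anc by simp
  have le: "Max (?c \<tau> ` insert k (anc k)) \<le> Max (?c \<sigma> ` insert k (anc k))" if k: "k \<in> D" for k
  proof (rule Max.boundedI)
    fix t assume "t \<in> ?c \<tau> ` insert k (anc k)"
    then obtain y where y: "t = ?c \<tau> y" "y \<in> insert k (anc k)" by auto
    \<comment> \<open>Only \<open>j\<close> itself finishes later, namely when \<open>i\<close> used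
      to. Whatever depends on \<open>j\<close> also depends on \<open>i\<close>, so the old value at
      \<open>i\<close> bounds the new one at \<open>j\<close>.\<close>
    let ?y = "if y = j then i else y"
    have "?y \<in> insert k (anc k)" "?c \<tau> y \<le> ?c \<sigma> ?y"
      using y R(2) c_j moved[of y] anc_trans[OF k, of j] anc_subset[OF k] k by auto
    moreover from this have "?c \<sigma> ?y \<le> Max (?c \<sigma> ` insert k (anc k))"
      using fin[OF k] by (intro Max_ge) auto
    ultimately show "t \<le> Max (?c \<sigma> ` insert k (anc k))"
      using y(1) by linarith
  qed (use fin[OF k] in auto)
  have "i \<in> D" using R dist by auto
  have "Max (?c \<tau> ` insert i (anc i)) < Max (?c \<sigma> ` insert i (anc i))"
  proof (rule less_le_trans)
    show "Max (?c \<tau> ` insert i (anc i)) < ?c \<sigma> i"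
      using early fin[OF \<open>i \<in> D\<close>] by (subst Max_less_iff) auto
    show "?c \<sigma> i \<le> Max (?c \<sigma> ` insert i (anc i))"
      using fin[OF \<open>i \<in> D\<close>] by (intro Max_ge) auto
  qed
  then have "delay_cost \<tau> < delay_cost \<sigma>"
    unfolding delay_cost_def using le w_pos \<open>i \<in> D\<close> finite_D
    by (intro sum_strict_mono_ex1) (auto simp: less_imp_le intro!: mult_left_mono bexI[of _ i])
  with rep' show thesis by (rule that)
qed

section \<open>Optimal and greedy sequences\<close>

lemma optimal_topo: "optimal \<sigma> \<Longrightarrow> topo \<sigma>"
  unfolding optimal_def by (meson not_topo_improvable not_less)

lemma optimal_greedy:
  assumes "optimal \<sigma>"
  shows "greedy \<sigma>"
  unfolding greedy_def
proof (intro allI impI conjI ballI)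
  fix xs j ys k
  assume \<sigma>: "\<sigma> = xs @ j # ys"
  have topo: "topo \<sigma>" and rep: "repair_sequence D \<sigma>"
    using assms optimal_topo by (auto simp: optimal_def)
  show "j \<in> ready (set xs)"
    using topo rep \<sigma> topoD by (auto simp: ready_def repair_sequence_def)
  assume k: "k \<in> ready (set xs)"
  show "density k \<le> density j"
  proof (rule ccontr)
    assume less: "\<not> density k \<le> density j"
    \<comment> \<open>The line \<open>k\<close> merely beats \<open>j\<close>, whereas
      \<open>exchange\<close> asks for a densest ready line \<open>l\<close>.\<close>
    have "finite (ready (set xs))"
      using finite_D by (simp add: ready_def)
    then obtain l where l: "l \<in> ready (set xs)" "\<forall>i\<in>ready (set xs). density i \<le> density l"
      using k obtains_MAX[of "ready (set xs)" density] by (metis Max_ge emptyE finite_imageI imageI)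
    with k less have "density j < density l"
      by fastforce
    then obtain v where "repair_sequence D (xs @ l # v)" "topo (xs @ l # v)"
      "cost p w (xs @ l # v) < cost p w \<sigma>"
      using exchange[of xs j ys l] topo rep \<sigma> l by metis
    then show False
      using assms topo rep by (auto simp: optimal_def delay_cost_topo)
  qed
qed

text \<open>Among lines of equal density, a given optimal sequence may prefer another one. An
  optimal extension of the shorter prefix is therefore repaired at each step by
  \<open>exchange\<close>, at no cost.\<close>

lemma greedy_extends_to_optimal:
  assumes "greedy u"
  obtains v where "optimal (u @ v)"
proof -
  have "\<exists>v. optimal (u @ v)"
    using assms
  proof (induction u rule: rev_induct)
    case Nil
    then show ?case using optimal_exists by simp
  next
    case (snoc l u)
    then have l: "l \<in> ready (set u)" "\<forall>k\<in>ready (set u). density k \<le> density l"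
      by (auto simp: greedy_snoc)
    from snoc obtain v where v: "optimal (u @ v)"
      by (auto simp: greedy_snoc)
    then have "v \<noteq> []"
      using l by (auto simp: optimal_def repair_sequence_def ready_def)
    then obtain x v1 where "v = x # v1"
      by (cases v) auto
    then obtain v' where "repair_sequence D (u @ l # v')" "topo (u @ l # v')"
      "cost p w (u @ l # v') \<le> cost p w (u @ v)"
      using exchange[of u x v1 l] v l optimal_topo by (metis optimal_def)
    then have "optimal (u @ l # v')"
      using v optimal_topo[OF v] by (fastforce simp: optimal_def delay_cost_topo)
    then show ?case by auto
  qed
  then show thesis using that by blast
qed

end

section \<open>Damaged lines upstream of a line\<close>

text \<open>Used with properties of the route to a node, to show that a component of
  \<open>A\<close> stays within a certain part of the network.\<close>

lemma joined_invariant: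
  assumes "u \<in> joined G A v" "\<And>e. e \<in> A \<Longrightarrow> P (head G e) \<longleftrightarrow> P (tail G e)" "P v"
  shows "P u"
proof -
  have "(v, u) \<in> (arc_to_ends G ` A \<union> (arc_to_ends G ` A)\<inverse>)\<^sup>*"
    using assms(1) by (simp add: joined_def)
  then show ?thesis
    using assms(2,3) by (induction rule: rtrancl_induct) (auto simp: arc_to_ends_def)
qed

lemma joined_self: "v \<in> joined G A v"
  by (simp add: joined_def)

lemma joined_eq:
  assumes "u \<in> joined G A v"
  shows "joined G A u = joined G A v"
proof -
  let ?r = "arc_to_ends G ` A \<union> (arc_to_ends G ` A)\<inverse>"
  have "sym (?r\<^sup>*)"
    by (intro sym_rtrancl sym_Un_converse)
  then have "(v, u) \<in> ?r\<^sup>*" "(u, v) \<in> ?r\<^sup>*"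
    using assms by (auto simp: joined_def dest: symD)
  then show ?thesis
    unfolding joined_def by (auto intro: rtrancl_trans)
qed

lemma (in wf_digraph) awalk_joined:
  "awalk u q v \<Longrightarrow> set q \<subseteq> A \<Longrightarrow> v \<in> joined G A u"
proof (induction q arbitrary: u)
  case Nil
  then show ?case by (simp add: awalk_Nil_iff joined_self)
next
  case (Cons e q)
  then have "v \<in> joined G A (head G e)" "tail G e = u" "e \<in> A"
    by (auto simp: awalk_Cons_iff)
  then show ?case
    unfolding joined_def
    by (auto simp: arc_to_ends_def intro: converse_rtrancl_into_rtrancl)
qed

locale radial_network =
  fixes G :: "('v, 'l) pre_digraph" and src :: 'v and D :: "'l set" and p w :: "'l \<Rightarrow> real"
  assumes damaged_network: "damaged_network G src D p w"
begin

sublocale wf_digraph G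
  using damaged_network by (simp add: damaged_network_def rooted_tree_def)

section \<open>Routes from the source\<close>

lemma D_subset: "D \<subseteq> arcs G"
  and src_in_verts: "src \<in> verts G"
  and unique_walk: "v \<in> verts G \<Longrightarrow> \<exists>!q. awalk src q v"
  using damaged_network by (auto simp: damaged_network_def rooted_tree_def)

definition route :: "'v \<Rightarrow> 'l list" where
  "route v = (THE q. awalk src q v)"

text \<open>Plays the role of \<open>anc\<close>; by \<open>reachable_P_iff\<close> these are the
  proper predecessors of \<open>l\<close> in the soft precedence graph.\<close>

definition upstream :: "'l \<Rightarrow> 'l set" where
  "upstream l = set (route (tail G l)) \<inter> D"

lemma awalk_route: "v \<in> verts G \<Longrightarrow> awalk src (route v) v"
  unfolding route_def by (rule theI') (rule unique_walk)

lemma route_eq: "awalk src q v \<Longrightarrow> route v = q"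
  using awalk_route unique_walk awalk_last_in_verts by metis

lemma route_src: "route src = []"
  using src_in_verts by (intro route_eq) (simp add: awalk_Nil_iff)

lemma route_head:
  assumes "e \<in> arcs G"
  shows "route (head G e) = route (tail G e) @ [e]"
  using assms awalk_route[of "tail G e"]
  by (intro route_eq awalk_appendI[where v = "tail G e"]) (auto intro: arc_implies_awalk)

lemma route_split:
  assumes "v \<in> verts G" "route v = xs @ e # ys"
  shows "e \<in> arcs G" "route (tail G e) = xs" "awalk (head G e) ys v"
  using awalk_route[OF assms(1)] assms(2) by (auto simp: awalk_Cons_iff intro: route_eq)

text \<open>A line occurring twice would give its tail two routes of different lengths.\<close>

lemma distinct_route:
  assumes "v \<in> verts G"
  shows "distinct (route v)"
proof (rule ccontr)
  assume "\<not> distinct (route v)"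
  then obtain xs e ys zs where "route v = xs @ [e] @ ys @ [e] @ zs"
    using not_distinct_decomp by blast
  then show False
    using route_split(2)[OF assms, of xs e "ys @ e # zs"] route_split(2)[OF assms, of "xs @ e # ys" e zs]
    by simp
qed

text \<open>The part of a route before one of its lines is itself the route to the tail of that
  line.\<close>

lemma route_comparable:
  assumes "v \<in> verts G" "i \<in> set (route v)" "k \<in> set (route v)"
  shows "i = k \<or> i \<in> set (route (tail G k)) \<or> k \<in> set (route (tail G i))"
proof -
  obtain xs ys where i: "route v = xs @ i # ys"
    using assms(2) by (meson split_list)
  then consider "k \<in> set xs" | "k = i" | "k \<in> set ys"
    using assms(3) by auto
  then show ?thesis
  proof cases
    case 3
    then obtain as bs where "ys = as @ k # bs"
      by (meson split_list)
    then show ?thesis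
      using route_split(2)[OF assms(1), of "xs @ i # as" k bs] i by simp
  qed (use route_split(2)[OF assms(1) i] in auto)
qed

lemma route_tail_subset:
  assumes "v \<in> verts G" "i \<in> set (route v)"
  shows "set (route (tail G i)) \<subseteq> set (route v)"
proof -
  obtain xs ys where "route v = xs @ i # ys"
    using assms(2) by (meson split_list)
  then show ?thesis
    using route_split(2)[OF assms(1)] by auto
qed

lemma tail_in_verts: "l \<in> D \<Longrightarrow> tail G l \<in> verts G"
  using D_subset by auto

sublocale precedence_forest D upstream p w
proof
  show "finite D" "\<And>j. j \<in> D \<Longrightarrow> 0 < p j" "\<And>j. j \<in> D \<Longrightarrow> 0 < w j"
    using damaged_network by (auto simp: damaged_network_def)
  fix j assume j: "j \<in> D"
  show "upstream j \<subseteq> D"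
    by (simp add: upstream_def)
  show "j \<notin> upstream j"
    using distinct_route[of "head G j"] route_head[of j] j D_subset by (auto simp: upstream_def)
  fix i assume i: "i \<in> upstream j"
  then show "upstream i \<subseteq> upstream j"
    using route_tail_subset[OF tail_in_verts[OF j]] by (auto simp: upstream_def)
  fix k assume "k \<in> upstream j"
  then show "i = k \<or> i \<in> upstream k \<or> k \<in> upstream i"
    using i route_comparable[OF tail_in_verts[OF j], of i k] by (auto simp: upstream_def)
qed

section \<open>Soft precedence in terms of routes\<close>

lemma upstream_head:
  "e \<in> arcs G \<Longrightarrow> set (route (head G e)) \<inter> D = set (route (tail G e)) \<inter> D \<union> ({e} \<inter> D)"
  by (auto simp: route_head)

text \<open>Intact lines do not change the set of damaged lines on a route, so this set depends only
  on the contracted node. Conversely, equal sets leave only intact lines on the route from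
  \<open>i\<close> to \<open>j\<close>, and these join the two nodes.\<close>

lemma t_node_eq_h_node_iff:
  assumes "i \<in> D" "j \<in> D"
  shows "t_node G D i = h_node G D j \<longleftrightarrow> upstream j = insert i (upstream i)"
proof
  have up: "set (route (head G i)) \<inter> D = insert i (upstream i)"
    using upstream_head[of i] assms D_subset unfolding upstream_def by blast
  let ?I = "arcs G - D"
  {
    assume "t_node G D i = h_node G D j"
    then have "tail G j \<in> joined G ?I (head G i)"
      using joined_self by (metis h_node_def t_node_def)
    then have "set (route (tail G j)) \<inter> D = insert i (upstream i)"
      by (rule joined_invariant) (auto simp: upstream_head up)
    then show "upstream j = insert i (upstream i)"
      by (simp add: upstream_def)
  next
    assume eq: "upstream j = insert i (upstream i)"
    then have "i \<in> set (route (tail G j))"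
      by (auto simp: upstream_def)
    then obtain xs ys where r: "route (tail G j) = xs @ i # ys"
      by (meson split_list)
    note split = route_split[OF tail_in_verts[OF assms(2)] r]
    \<comment> \<open>A damaged line after \<open>i\<close> would also be \<open>i\<close> or lie
      before \<open>i\<close>, and so occur twice on the route.\<close>
    have "e \<notin> D" if "e \<in> set ys" for e
    proof
      assume "e \<in> D"
      then have "e \<in> insert i (upstream i)"
        using that r unfolding eq[symmetric] by (simp add: upstream_def)
      then show False
        using that r split(2) distinct_route[OF tail_in_verts[OF assms(2)]] by (auto simp: upstream_def)
    qed
    then have "set ys \<subseteq> ?I"
      using split(3) by (auto simp: awalk_def)
    then have "tail G j \<in> joined G ?I (head G i)"
      using split(3) awalk_joined by blast
    then show "t_node G D i = h_node G D j"
      by (simp add: t_node_def h_node_def joined_eq)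
  }
qed

abbreviation P :: "('l, 'l \<times> 'l) pre_digraph" where
  "P \<equiv> soft_precedence G D"

lemma arc_P_iff:
  "(i, j) \<in> arcs P \<longleftrightarrow> i \<in> D \<and> j \<in> D \<and> upstream j = insert i (upstream i)"
  by (simp add: soft_precedence_def t_node_eq_h_node_iff cong: conj_cong)

lemma P_simps [simp]: "verts P = D" "tail P = fst" "head P = snd"
  by (simp_all add: soft_precedence_def)

lemma dominates_P_iff:
  "i \<rightarrow>\<^bsub>P\<^esub> j \<longleftrightarrow> i \<in> D \<and> j \<in> D \<and> upstream j = insert i (upstream i)"
  unfolding arcs_ends_def arc_to_ends_def using arc_P_iff by (auto simp: image_iff)

lemma wf_P: "wf_digraph P"
  by unfold_locales (auto simp: arc_P_iff)

lemma parent_exists: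
  assumes "j \<in> D" "upstream j \<noteq> {}"
  obtains i where "(i, j) \<in> arcs P"
  using anc_eq_insert[OF assms] anc_subset[OF assms(1)] assms(1) arc_P_iff by (metis subsetD)

text \<open>Each arc adds just the immediate predecessor to the upstream set; conversely, climb from
  \<open>j\<close> along immediate predecessors until \<open>i\<close> is met.\<close>

lemma reachable_P_iff: "i \<rightarrow>\<^sup>*\<^bsub>P\<^esub> j \<longleftrightarrow> j \<in> D \<and> i \<in> insert j (upstream j)"
proof
  assume "i \<rightarrow>\<^sup>*\<^bsub>P\<^esub> j"
  then have "(i, j) \<in> rtrancl_on D (arcs_ends P)"
    by (simp add: reachable_def)
  then show "j \<in> D \<and> i \<in> insert j (upstream j)"
    by (induction rule: rtrancl_on_induct) (auto simp: dominates_P_iff)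
next
  interpret P: wf_digraph P by (rule wf_P)
  assume "j \<in> D \<and> i \<in> insert j (upstream j)"
  then have "j \<in> D" "i \<in> insert j (upstream j)" by auto
  then show "i \<rightarrow>\<^sup>*\<^bsub>P\<^esub> j"
  proof (induction j rule: anc_induct)
    case (step j)
    show ?case
    proof (cases "i = j")
      case True
      then show ?thesis using step(1) by simp
    next
      case False
      then have "upstream j \<noteq> {}" using step by auto
      then obtain k where k: "(k, j) \<in> arcs P"
        using parent_exists step(1) by blast
      then have "i \<in> insert k (upstream k)" "k \<in> upstream j"
        using step(3) False by (auto simp: arc_P_iff)
      then have "i \<rightarrow>\<^sup>*\<^bsub>P\<^esub> k"
        using step(2)[of k] by simp
      moreover have "k \<rightarrow>\<^bsub>P\<^esub> j"
        using k by (simp add: dominates_P_iff arc_P_iff)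
      ultimately show ?thesis
        by (rule P.reachable_adj_trans)
    qed
  qed
qed

lemma optimal_sequence_iff: "optimal_sequence G D p w \<sigma> \<longleftrightarrow> optimal \<sigma>"
proof -
  have "energization_time G D C j = Max (C ` insert j (upstream j))" if "j \<in> D" for C j
    unfolding energization_time_def reachable_P_iff using that
    by (intro arg_cong[of _ _ Max]) auto
  then have "harm G D w (sequence_completion p \<tau>) = delay_cost \<tau>" for \<tau>
    by (simp add: harm_def delay_cost_def)
  then show ?thesis
    by (simp add: optimal_sequence_def optimal_def)
qed

section \<open>Subtrees and the \<rho>-factor\<close>

lemma rooted_tree_imp_tree_at:
  assumes "s \<in> trees_at G D l"
  shows "tree_at l (verts s)"
proof -
  have s: "subgraph s P" "rooted_tree s l"
    using assms by (auto simp: trees_at_def)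
  then have sub: "verts s \<subseteq> D" "arcs s \<subseteq> arcs P" "tail s = fst" "head s = snd"
    by (auto simp: subgraph_def compatible_def)
  interpret s: wf_digraph s
    using s(1) by (simp add: subgraph_def)
  \<comment> \<open>Induction along a walk from \<open>l\<close>: a step from \<open>x\<close> to
    \<open>y\<close> enlarges the upstream set by \<open>x\<close> only, and \<open>x\<close> is
    already known to be a vertex of \<open>s\<close>.\<close>
  have reach: "x \<in> verts s \<and> l \<in> insert x (upstream x) \<and> {y \<in> upstream x. l \<in> insert y (upstream y)} \<subseteq> verts s"
    if "l \<rightarrow>\<^sup>*\<^bsub>s\<^esub> x" for x
    using that
  proof (induction rule: s.reachable_induct)
    case base
    then have "l \<in> D"
      using sub(1) by auto
    then have "{y \<in> upstream l. l \<in> insert y (upstream y)} = {}"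
      using anc_trans[of l] anc_irrefl[of l] by auto
    with base show ?case by auto
  next
    case (step x y)
    then have "(x, y) \<in> arcs P"
      using sub by (auto simp: arcs_ends_def arc_to_ends_def)
    moreover have "y \<in> verts s"
      using step(2) s.adj_in_verts by blast
    ultimately show ?case
      using step(3) by (auto simp: arc_P_iff)
  qed
  have "l \<rightarrow>\<^sup>*\<^bsub>s\<^esub> x" if "x \<in> verts s" for x
    using s(2) that s.reachable_awalk[of l x] by (auto simp: rooted_tree_def)
  then have x: "l \<in> insert x (upstream x) \<and> {y \<in> upstream x. l \<in> insert y (upstream y)} \<subseteq> verts s"
    if "x \<in> verts s" for x
    using reach that by blast
  have "l \<in> verts s"
    using s(2) by (simp add: rooted_tree_def)
  then show ?thesis
    using x sub(1) unfolding tree_at_def by blast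
qed

text \<open>The induced subgraph serves as the tree: the closure property of \<open>N\<close> keeps
  the immediate predecessor of each member other than \<open>l\<close>, which gives a walk from
  \<open>l\<close>, and uniqueness of immediate predecessors makes it the only one.\<close>

lemma tree_at_imp_rooted_tree:
  assumes "tree_at l N"
  shows "P \<restriction> N \<in> trees_at G D l"
proof -
  interpret P: wf_digraph P by (rule wf_P)
  have N: "N \<subseteq> D" "l \<in> N"
    using assms by (auto simp: tree_at_def)
  interpret s: wf_digraph "P \<restriction> N"
    by (rule P.wellformed_induce_subgraph)
  have "\<exists>!q. s.awalk l q x" if "x \<in> D" "x \<in> N" for x
    using that
  proof (induction x rule: anc_induct)
    case (step x)
    have root: "x = l" if "s.awalk l [] x"
      using that by (simp add: s.awalk_Nil_iff)
    \<comment> \<open>Two different immediate predecessors of \<open>x\<close> would lie upstream of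
      each other, so the last arc is forced. The first conjunct excludes nonempty walks back to
      \<open>l\<close>.\<close>
    have last: "l \<in> upstream x \<and> e = (y, x) \<and> s.awalk l q y"
      if "s.awalk l (q @ [e]) x" "(y, x) \<in> arcs P" for q e y
    proof -
      have q: "s.awalk l q (fst e)" and e: "e \<in> arcs P" "snd e = x"
        using that(1) by (auto simp: s.awalk_Cons_iff s.awalk_Nil_iff)
      have "(fst e, x) \<in> arcs P" using e by auto
      then have "upstream x = insert (fst e) (upstream (fst e))" "fst e \<in> D"
        "upstream x = insert y (upstream y)" "y \<in> D"
        using that(2) by (simp_all add: arc_P_iff)
      then have "fst e = y"
        using psubset_anc anc_irrefl by (metis insertE insertI1 psubset_imp_subset subsetD)
      moreover have "l \<rightarrow>\<^sup>*\<^bsub>P \<restriction> N\<^esub> fst e"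
        using q s.reachable_awalk by blast
      then have "l \<rightarrow>\<^sup>*\<^bsub>P\<^esub> fst e"
        using N P.reachable_induce_subgraphD by auto
      then have "l \<in> upstream x"
        using \<open>upstream x = insert (fst e) _\<close> by (auto simp: reachable_P_iff)
      ultimately show ?thesis
        using e q by auto
    qed
    show ?case
    proof (cases "x = l")
      case True
      have "q = []" if "s.awalk l q x" for q
      proof (cases q rule: rev_cases)
        case (snoc q' e)
        then have e: "e \<in> arcs P" "snd e = x"
          using that by (auto simp: s.awalk_Cons_iff s.awalk_Nil_iff)
        then have "(fst e, x) \<in> arcs P" by auto
        then show ?thesis
          using last[of q' e "fst e"] that snoc True anc_irrefl step(1) by auto
      qed
      moreover have "s.awalk l [] x"
        using True N by (simp add: s.awalk_Nil_iff)
      ultimately show ?thesis by blast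
    next
      case False
      then have l: "l \<in> upstream x" "\<And>y. y \<in> upstream x \<Longrightarrow> l \<in> upstream y \<Longrightarrow> y \<in> N"
        using assms step(3) unfolding tree_at_def by blast+
      then obtain y where y: "(y, x) \<in> arcs P"
        using parent_exists step(1) by blast
      then have "y \<in> upstream x" "y \<in> N"
        using l N(2) by (auto simp: arc_P_iff)
      then have "\<exists>!q. s.awalk l q y"
        using step(2)[of y] N(1) by blast
      then obtain q where q: "s.awalk l q y" "\<And>q'. s.awalk l q' y \<Longrightarrow> q' = q"
        by blast
      have "s.awalk l (q @ [(y, x)]) x"
        using q(1) y \<open>y \<in> N\<close> step(3) by (auto simp: s.awalk_Cons_iff s.awalk_Nil_iff)
      moreover have "q' = q @ [(y, x)]" if q': "s.awalk l q' x" for q'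
      proof (cases q' rule: rev_cases)
        case Nil
        then show ?thesis using q' root False by simp
      next
        case (snoc q1 e)
        then show ?thesis using q' last[of q1 e y] y q(2) by auto
      qed
      ultimately show ?thesis by blast
    qed
  qed
  then have "rooted_tree (P \<restriction> N) l"
    unfolding rooted_tree_def using N s.wf_digraph_axioms
    by (simp only: induce_subgraph_verts) (blast dest: subsetD)
  moreover have "subgraph (P \<restriction> N) P"
    using N(1) wf_P s.wf_digraph_axioms by (simp add: subgraph_def compatible_def subset_iff)
  ultimately show ?thesis
    by (simp add: trees_at_def)
qed

lemma rho_eq_density: "rho G D p w l = density l"
proof -
  have eq: "Collect (tree_at l) = verts ` trees_at G D l"
  proof (intro equalityI subsetI)
    fix N assume "N \<in> Collect (tree_at l)"
    then show "N \<in> verts ` trees_at G D l"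
      by (intro image_eqI[where x = "P \<restriction> N"]) (simp_all add: tree_at_imp_rooted_tree)
  qed (auto dest: rooted_tree_imp_tree_at)
  then show ?thesis
    unfolding rho_def density_def by (simp add: eq image_image)
qed

end

section \<open>Candidates and runs\<close>

context radial_network
begin

text \<open>From the source or an endpoint of an assigned line, operational lines lead only to nodes
  on whose route all damaged lines are assigned. Conversely, the last non-operational line on the
  route to a ready line is under repair and connected to it; if there is none, the tail of the ready
  line is energized.\<close>

lemma candidates_eq_ready:
  assumes assigned: "line ` set H \<subseteq> D" "\<And>i. i \<in> line ` set H \<Longrightarrow> upstream i \<subseteq> line ` set H"
    and started: "\<And>a. a \<in> set H \<Longrightarrow> start a \<le> t"
  shows "candidates G src D p H t = ready (line ` set H)"
proof -
  define A where "A = line ` set H"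
  define Op where "Op = operational G D p H t"
  have Op: "e \<in> arcs G \<and> (e \<in> D \<longrightarrow> e \<in> A)" if "e \<in> Op" for e
    using that D_subset by (auto simp: Op_def operational_def repaired_def A_def)
  \<comment> \<open>Here \<open>started\<close> matters: an assignment in the future would be
    neither repaired nor under repair.\<close>
  have operational_or_repairing: "e \<in> Op \<or> e \<in> under_repair p H t" if "e \<in> arcs G" "e \<in> D \<longrightarrow> e \<in> A" for e
    using that started unfolding Op_def operational_def repaired_def under_repair_def A_def by force
  have repairing: "i \<in> A" if "i \<in> under_repair p H t" for i
    using that by (auto simp: under_repair_def A_def)
  let ?in = "\<lambda>v. set (route v) \<inter> D \<subseteq> A"
  have joined_in: "?in u" if "u \<in> joined G Op v" "?in v" for u v
    using that(1)
  proof (rule joined_invariant)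
    fix e assume "e \<in> Op"
    then show "?in (head G e) \<longleftrightarrow> ?in (tail G e)"
      using Op[of e] upstream_head[of e] by auto
  qed (rule that(2))
  have "j \<in> candidates G src D p H t \<longleftrightarrow> j \<in> ready A" if j: "j \<in> D" "j \<notin> A" for j
  proof
    assume "j \<in> candidates G src D p H t"
    then obtain u where u: "u \<in> endpoints G j" and
      "u \<in> joined G Op src \<or>
        (\<exists>i \<in> under_repair p H t. \<exists>v \<in> endpoints G i. u \<in> joined G Op v)"
      by (auto simp: candidates_def energized_def Op_def)
    then have "?in u"
    proof (elim disjE bexE)
      assume "u \<in> joined G Op src"
      then show ?thesis
        by (rule joined_in) (simp add: route_src)
    next
      fix i v assume i: "i \<in> under_repair p H t" and v: "v \<in> endpoints G i" and "u \<in> joined G Op v"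
      have "i \<in> A" "i \<in> arcs G" "upstream i \<subseteq> A"
        using repairing[OF i] assigned D_subset by (auto simp: A_def)
      then have "?in (tail G i)" "?in (head G i)"
        using upstream_head[of i] by (auto simp: upstream_def)
      with v have "?in v" by (auto simp: endpoints_def)
      with \<open>u \<in> joined G Op v\<close> show ?thesis by (rule joined_in)
    qed
    \<comment> \<open>The route to \<open>head G j\<close> contains the unassigned line
      \<open>j\<close>, so the connecting endpoint must be the tail.\<close>
    moreover have "\<not> ?in (head G j)"
      using j D_subset route_head[of j] by auto
    ultimately have "upstream j \<subseteq> A"
      using u by (auto simp: endpoints_def upstream_def)
    then show "j \<in> ready A"
      using j by (simp add: ready_def)
  next
    assume "j \<in> ready A"
    then have up: "set (route (tail G j)) \<inter> D \<subseteq> A"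
      by (simp add: ready_def upstream_def)
    have walk: "awalk src (route (tail G j)) (tail G j)"
      using awalk_route tail_in_verts j(1) by blast
    show "j \<in> candidates G src D p H t"
    proof (cases "set (route (tail G j)) \<subseteq> Op")
      case True
      then have "tail G j \<in> energized G src D p H t"
        using awalk_joined[OF walk] by (simp add: energized_def Op_def)
      then show ?thesis
        using j by (auto simp: candidates_def endpoints_def A_def)
    next
      case False
      then have "\<exists>i\<in>set (route (tail G j)). i \<notin> Op" by auto
      then obtain xs i ys where r: "route (tail G j) = xs @ i # ys" "i \<notin> Op" "\<forall>k\<in>set ys. \<not> k \<notin> Op"
        using split_list_last_prop[of "route (tail G j)" "\<lambda>i. i \<notin> Op"] by blast
      note split = route_split[OF tail_in_verts[OF j(1)] r(1)]
      have "i \<in> under_repair p H t"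
        using operational_or_repairing[OF split(1)] r up by auto
      moreover have "tail G j \<in> joined G Op (head G i)"
        using awalk_joined[OF split(3)] r(3) by blast
      ultimately show ?thesis
        using j unfolding candidates_def endpoints_def A_def Op_def by blast
    qed
  qed
  moreover have "candidates G src D p H t \<subseteq> D - A" "ready A \<subseteq> D - A"
    by (auto simp: candidates_def ready_def A_def)
  ultimately show ?thesis
    unfolding A_def[symmetric] by blast
qed

text \<open>An invariant of both algorithms; it supplies the hypothesis \<open>started\<close> of
  \<open>candidates_eq_ready\<close> at every time at which a crew is free.\<close>

definition prompt :: "nat \<Rightarrow> 'l assignment list \<Rightarrow> bool" where
  "prompt m H \<longleftrightarrow>
    (\<forall>t\<ge>0. (\<exists>c<m. crew_free p H c t) \<longrightarrow> (\<forall>a\<in>set H. start a \<le> t))"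

lemma prompt_Nil: "prompt m []"
  by (simp add: prompt_def)

lemma crew_free_appendD: "crew_free p (H @ H') c t \<Longrightarrow> crew_free p H c t"
  by (simp add: crew_free_def)

text \<open>A further assignment can only keep crews busy, so a crew free after it was free before
  it, and \<open>a\<close> starts no later than the first such time.\<close>

lemma prompt_snoc:
  assumes "prompt m H" "\<forall>t. 0 \<le> t \<and> t < start a \<longrightarrow> \<not> (\<exists>c<m. crew_free p H c t)"
  shows "prompt m (H @ [a])"
  unfolding prompt_def
proof (intro allI impI ballI)
  fix t b
  assume t: "0 \<le> t" "\<exists>c<m. crew_free p (H @ [a]) c t" and b: "b \<in> set (H @ [a])"
  then have "\<exists>c<m. crew_free p H c t"
    using crew_free_appendD by blast
  then show "start b \<le> t"
    using assms t(1) b by (force simp: prompt_def)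
qed

text \<open>Brings the dispatch step into the shape of a conversion step, up to the choice of the
  line. While a crew is free the candidate set is the fixed set \<open>?R\<close>; as it contains
  \<open>line a\<close>, the condition that a candidate exists is automatic.\<close>

lemma dispatch_step_iff:
  assumes greedy: "greedy (map line H)" and prompt: "prompt m H"
  shows "dispatch_step G src D p w m H a \<longleftrightarrow>
    0 \<le> start a \<and> crew a < m \<and> crew_free p H (crew a) (start a) \<and>
    greedy (map line (H @ [a])) \<and>
    (\<forall>t. 0 \<le> t \<and> t < start a \<longrightarrow> \<not> (\<exists>c < m. crew_free p H c t))"
proof -
  let ?R = "ready (line ` set H)"
  have cand: "candidates G src D p H t = ?R" if "0 \<le> t" "\<exists>c<m. crew_free p H c t" for t
    using prompt that greedy_assigned[OF greedy]
    by (intro candidates_eq_ready) (auto simp: prompt_def)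
  have greedy_iff: "greedy (map line (H @ [a])) \<longleftrightarrow>
      line a \<in> ?R \<and> (\<forall>j\<in>?R. rho G D p w j \<le> rho G D p w (line a))"
    using greedy by (simp add: greedy_snoc rho_eq_density)
  have earliest: "((\<exists>c < m. crew_free p H c t) \<and> candidates G src D p H t \<noteq> {}) \<longleftrightarrow>
      (\<exists>c < m. crew_free p H c t)" if "line a \<in> ?R" "0 \<le> t" for t
    using cand[OF that(2)] that(1) by auto
  show ?thesis
  proof (cases "0 \<le> start a \<and> crew a < m \<and> crew_free p H (crew a) (start a)")
    case True
    then have "candidates G src D p H (start a) = ?R"
      using cand by blast
    then show ?thesis
      unfolding dispatch_step_def greedy_iff using True earliest
      by (cases "line a \<in> ?R") simp_all
  qed (auto simp: dispatch_step_def)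
qed

text \<open>The continuation \<open>v\<close> is arbitrary because a conversion run reads only the
  lines it has assigned; it is chosen later to make the list optimal.\<close>

lemma dispatch_run_imp:
  assumes "dispatch_run G src D p w m H"
  shows "greedy (map line H) \<and> prompt m H \<and> (\<forall>v. conversion_run p m (map line H @ v) H)"
  using assms
proof (induction rule: run.induct)
  case run_Nil
  then show ?case
    by (auto simp: greedy_def prompt_Nil intro: run.run_Nil)
next
  case (run_snoc H a)
  then have greedy: "greedy (map line H)" and prompt: "prompt m H"
    and conv: "\<And>v. conversion_run p m (map line H @ v) H"
    by blast+
  have step: "0 \<le> start a \<and> crew a < m \<and> crew_free p H (crew a) (start a)"
    "greedy (map line (H @ [a]))"
    "\<forall>t. 0 \<le> t \<and> t < start a \<longrightarrow> \<not> (\<exists>c < m. crew_free p H c t)"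
    using run_snoc.hyps(2) dispatch_step_iff[OF greedy prompt] by blast+
  have "conversion_run p m (map line (H @ [a]) @ v) (H @ [a])" for v
  proof (rule run.run_snoc)
    show "conversion_run p m (map line (H @ [a]) @ v) H"
      using conv[of "line a # v"] by simp
    show "conversion_step p m (map line (H @ [a]) @ v) H a"
      using step by (simp add: conversion_step_def nth_append)
  qed
  then show ?case
    using step(2) prompt_snoc[OF prompt step(3)] by blast
qed

lemma conversion_run_imp:
  assumes "conversion_run p m \<sigma> H" "greedy \<sigma>"
  shows "map line H = take (length H) \<sigma> \<and> prompt m H \<and> dispatch_run G src D p w m H"
  using assms(1)
proof (induction rule: run.induct)
  case run_Nil
  then show ?case
    by (simp add: prompt_Nil run.run_Nil)
next
  case (run_snoc H a)
  then have H: "map line H = take (length H) \<sigma>" and prompt: "prompt m H"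
    and run: "dispatch_run G src D p w m H"
    by blast+
  have step: "0 \<le> start a \<and> crew a < m \<and> crew_free p H (crew a) (start a)"
    "length H < length \<sigma>" "line a = \<sigma> ! length H"
    "\<forall>t. 0 \<le> t \<and> t < start a \<longrightarrow> \<not> (\<exists>c < m. crew_free p H c t)"
    using run_snoc.hyps(2) by (auto simp: conversion_step_def)
  have H': "map line (H @ [a]) = take (length (H @ [a])) \<sigma>"
    using H step by (simp add: take_Suc_conv_app_nth)
  have prefix: "greedy (take k \<sigma>)" for k
    using assms(2) greedy_appendD[of "take k \<sigma>" "drop k \<sigma>"] by simp
  have "dispatch_step G src D p w m H a"
    using step H' prefix H by (subst dispatch_step_iff[OF _ prompt]) simp_all
  with run have "dispatch_run G src D p w m (H @ [a])"
    by (rule run.run_snoc)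
  then show ?case
    using H' prompt_snoc[OF prompt step(4)] by blast
qed

end

theorem theorem5:
  fixes G :: "('v, 'l) pre_digraph" and src :: 'v and D :: "'l set"
    and p w :: "'l \<Rightarrow> real" and m :: nat and H :: "'l assignment list"
  assumes "damaged_network G src D p w"
    and "m \<ge> 1"
  shows "dispatch_run G src D p w m H \<longleftrightarrow>
         (\<exists>\<sigma>. optimal_sequence G D p w \<sigma> \<and> conversion_run p m \<sigma> H)"
proof -
  interpret radial_network G src D p w
    by unfold_locales (rule assms(1))
  show ?thesis
  proof
    assume "dispatch_run G src D p w m H"
    note run = dispatch_run_imp[OF this]
    \<comment> \<open>The optimal sequence is built after the run, so it reproduces the way in which
      the run broke ties.\<close>
    then obtain v where "optimal (map line H @ v)"
      using greedy_extends_to_optimal by blast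
    with run show "\<exists>\<sigma>. optimal_sequence G D p w \<sigma> \<and> conversion_run p m \<sigma> H"
      unfolding optimal_sequence_iff by blast
  next
    assume "\<exists>\<sigma>. optimal_sequence G D p w \<sigma> \<and> conversion_run p m \<sigma> H"
    then show "dispatch_run G src D p w m H"
      using optimal_greedy conversion_run_imp by (auto simp: optimal_sequence_iff)
  qed
qed

end
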